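(* Let $n=p_1^{\alpha_1}p_2^{\alpha_2}\cdots p_k^{\alpha_k}$ with $k\ge3$, distinct primes $p_i$ and positive integers $\alpha_i$. Then the coefficient of the term of smallest degree in the domination polynomial of $\Gamma(\mathbb{Z}_n)$ (i.e. the number of dominating sets of minimum size) equals $(p_1-1)(p_2-1)\cdots(p_k-1)$.
   Context: For a commutative ring $R$ with identity, the zero-divisor graph $\Gamma(R)$ is the simple undirected graph whose vertices are the nonzero zero-divisors of $R$, two distinct vertices $u,v$ being adjacent iff $uv=0$. A dominating set of a graph $G$ is a set $D$ of vertices such that every vertex not in $D$ is adjacent to a vertex of $D$. The domination polynomial of $G$ is $\sum_{i} d(G,i)x^i$, where $d(G,i)$ is the number of dominating sets of $G$ of size $i$; its term of smallest degree has degree equal to the domination number of $G$. *)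

theory Defs
  imports
    "HOL-Number_Theory.Residues"
    "HOL-Computational_Algebra.Polynomial"
    "Graph_Theory.Graph_Theory"
begin

definition zero_divisors :: "('a, 'm) ring_scheme \<Rightarrow> 'a set" where
  "zero_divisors R =
    {x \<in> carrier R. \<exists>y \<in> carrier R. y \<noteq> \<zero>\<^bsub>R\<^esub> \<and> x \<otimes>\<^bsub>R\<^esub> y = \<zero>\<^bsub>R\<^esub>}"

text \<open>
  A simple undirected graph is, as in the library, a loop-free symmetric digraph without
  parallel arcs: each undirected edge is represented by its two orientations
  (see \<open>pair_graph_zero_divisor_graph\<close> below). In a nontrivial ring zero itself belongs to
  \<open>zero_divisors\<close>, so it is removed from the vertices explicitly.
\<close>

definition zero_divisor_graph :: "('a, 'm) ring_scheme \<Rightarrow> 'a pair_pre_digraph" where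
  "zero_divisor_graph R =
    \<lparr> pverts = zero_divisors R - {\<zero>\<^bsub>R\<^esub>},
      parcs = {(u, v). u \<in> zero_divisors R - {\<zero>\<^bsub>R\<^esub>} \<and> v \<in> zero_divisors R - {\<zero>\<^bsub>R\<^esub>} \<and>
                       u \<noteq> v \<and> u \<otimes>\<^bsub>R\<^esub> v = \<zero>\<^bsub>R\<^esub>} \<rparr>"

lemma pair_graph_zero_divisor_graph:
  assumes "cring R" and fin: "finite (carrier R)"
  shows "pair_graph (zero_divisor_graph R)"
proof -
  interpret cring R by fact
  have sub: "zero_divisors R \<subseteq> carrier R"
    by (auto simp: zero_divisors_def)
  have finV: "finite (zero_divisors R)"
    using finite_subset[OF sub fin] .
  show ?thesis
  proof
    show "finite (parcs (zero_divisor_graph R))"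
      by (rule finite_subset[of _ "zero_divisors R \<times> zero_divisors R"])
        (use finV in \<open>auto simp: zero_divisor_graph_def\<close>)
    show "symmetric (with_proj (zero_divisor_graph R))"
      unfolding symmetric_def with_proj_simps
      by (rule symI) (use sub m_comm in \<open>auto simp: zero_divisor_graph_def subset_iff\<close>)
  qed (use finV in \<open>auto simp: zero_divisor_graph_def\<close>)
qed

definition dominating_set :: "('a, 'b) pre_digraph \<Rightarrow> 'a set \<Rightarrow> bool" where
  "dominating_set G D \<longleftrightarrow>
    D \<subseteq> verts G \<and> (\<forall>v \<in> verts G - D. \<exists>u \<in> D. v \<rightarrow>\<^bsub>G\<^esub> u)"

definition num_dominating_sets :: "('a, 'b) pre_digraph \<Rightarrow> nat \<Rightarrow> nat" where
  "num_dominating_sets G i = card {D. dominating_set G D \<and> card D = i}"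

definition domination_poly :: "('a, 'b) pre_digraph \<Rightarrow> int poly" where
  "domination_poly G = (\<Sum>i \<le> card (verts G). monom (int (num_dominating_sets G i)) i)"

definition domination_number :: "('a, 'b) pre_digraph \<Rightarrow> nat" where
  "domination_number G = (LEAST i. \<exists>D. dominating_set G D \<and> card D = i)"

text \<open>Only meaningful for nonzero polynomials.\<close>

definition lowest_degree :: "'a::zero poly \<Rightarrow> nat" where
  "lowest_degree f = (LEAST i. coeff f i \<noteq> 0)"

definition lowest_coeff :: "'a::zero poly \<Rightarrow> 'a" where
  "lowest_coeff f = coeff f (lowest_degree f)"

end

theory Submission
  imports Defs
begin

text \<open>
  For a prime \<open>q\<close> dividing \<open>N\<close>, the neighbours of the vertices \<open>q\<close> and \<open>N - q\<close> are exactly the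
  nonzero annihilators of \<open>q\<close> modulo \<open>N\<close>. So a dominating set \<open>D\<close> contains such an annihilator or
  both \<open>q\<close> and \<open>N - q\<close>; when \<open>N\<close> has three prime divisors, these conditions concern pairwise
  disjoint sets as \<open>q\<close> varies. Hence \<open>D\<close> has at least as many elements as \<open>N\<close> has prime divisors,
  and equality forces \<open>D\<close> to consist of precisely one annihilator for each prime \<open>q\<close>, with
  \<open>q - 1\<close> choices each. Conversely each such choice dominates, since every vertex shares some
  prime divisor with \<open>N\<close>.
\<close>

section \<open>Choice functions on a disjoint family\<close>

lemma disjoint_family_on_eqI:
  assumes "disjoint_family_on B P" "q \<in> P" "r \<in> P" "x \<in> B q" "x \<in> B r"
  shows "q = r"
  using assms unfolding disjoint_family_on_def by blast

text \<open>The image determines \<open>f\<close>: by disjointness its only element in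
  \<open>B q\<close> is \<open>f q\<close>. This lets sets of representatives be counted as choice
  functions.\<close>

lemma inj_on_image_PiE:
  assumes "disjoint_family_on B P"
  shows "inj_on (\<lambda>f. f ` P) (Pi\<^sub>E P B)"
proof (rule inj_onI)
  fix f g assume fg: "f \<in> Pi\<^sub>E P B" "g \<in> Pi\<^sub>E P B" "f ` P = g ` P"
  show "f = g"
  proof (rule PiE_ext[OF fg(1,2)])
    fix q assume q: "q \<in> P"
    then obtain r where r: "r \<in> P" "f q = g r" using fg(3) by blast
    have "f q \<in> B q" "g r \<in> B r" using fg(1,2) q r(1) by (auto simp only: PiE_mem)
    then show "f q = g q" using disjoint_family_on_eqI[OF assms q r(1)] r(2) by metis
  qed
qed

lemma inj_on_PiE_disjoint:
  assumes "disjoint_family_on B P" "f \<in> Pi\<^sub>E P B"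
  shows "inj_on f P"
  by (rule inj_onI) (metis PiE_mem assms disjoint_family_on_eqI)

text \<open>Applied to a disjoint family \<open>C\<close>, where such an \<open>f\<close> is
  injective on \<open>P\<close>, this yields \<open>card P\<close> distinct elements of
  \<open>D\<close>.\<close>

lemma transversal_exists:
  assumes "\<And>q. q \<in> P \<Longrightarrow> D \<inter> C q \<noteq> {}"
  obtains f where "f \<in> Pi\<^sub>E P C" "f ` P \<subseteq> D"
proof
  let ?f = "\<lambda>q\<in>P. SOME x. x \<in> D \<inter> C q"
  have "(SOME x. x \<in> D \<inter> C q) \<in> D \<inter> C q" if "q \<in> P" for q
    using assms[OF that] some_in_eq by blast
  then show "?f \<in> Pi\<^sub>E P C" "?f ` P \<subseteq> D" by auto
qed

section \<open>The zero-divisor graph of the integers modulo \<open>N\<close> in terms of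
  divisibility\<close>

lemma verts_zero_divisor_graph_residue_ring:
  assumes "N > 1"
  shows "verts (zero_divisor_graph (residue_ring N)) = {x \<in> {0<..<N}. \<not> coprime x N}"
proof -
  define Q where "Q x \<longleftrightarrow> (\<exists>y\<in>{0..N - 1}. y \<noteq> 0 \<and> x * y mod N = 0)" for x
  have "Q x \<longleftrightarrow> \<not> coprime x N"
    if x: "0 < x" "x < N" for x
  proof
    assume "Q x"
    then obtain y where "y \<in> {0..N - 1}" "y \<noteq> 0" "x * y mod N = 0"
      unfolding Q_def by (elim bexE conjE)
    then have y: "0 < y" "y < N" "N dvd x * y" by auto
    show "\<not> coprime x N"
    proof
      assume "coprime x N"
      then have "N dvd y"
        using y(3) by (simp add: coprime_commute coprime_dvd_mult_right_iff)
      then show False using y(1,2) zdvd_imp_le[of N y] by linarith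
    qed
  next
    assume nc: "\<not> coprime x N"
    \<comment> \<open>The cofactor \<open>b\<close> of \<open>g\<close> in \<open>N\<close> kills
      \<open>x\<close>, and it is a nonzero residue because \<open>g > 1\<close>.\<close>
    define g where "g = gcd x N"
    have g: "g dvd x" "g dvd N" "g \<ge> 0" "g \<noteq> 1" "g \<noteq> 0"
      using nc assms by (auto simp: g_def coprime_iff_gcd_eq_1)
    then have "g > 1" by linarith
    obtain a where a: "x = g * a" using g(1) by blast
    obtain b where b: "N = g * b" using g(2) by blast
    have "b > 0" using assms \<open>g > 1\<close> by (intro zero_less_mult_pos[of g b]) (simp_all flip: b)
    then have "b < N" using b \<open>g > 1\<close> by simp
    moreover have "x * b mod N = 0" by (simp add: a b)
    ultimately show "Q x"
      unfolding Q_def using \<open>b > 0\<close> by (intro bexI[of _ b] conjI) simp_all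
  qed
  moreover have "verts (zero_divisor_graph (residue_ring N)) = {x \<in> {0..N - 1}. Q x} - {0}"
    by (simp add: Q_def zero_divisor_graph_def zero_divisors_def residue_ring_def)
  moreover have "x \<in> {0..N - 1} - {0} \<longleftrightarrow> x \<in> {0<..<N}" for x by auto
  ultimately show ?thesis
    unfolding set_eq_iff Diff_iff mem_Collect_eq greaterThanLessThan_iff by metis
qed

lemma dominating_set_zero_divisor_graph_residue_ring:
  assumes "N > 1"
  defines "V \<equiv> {x \<in> {0<..<N}. \<not> coprime x N}"
  shows "dominating_set (zero_divisor_graph (residue_ring N)) D \<longleftrightarrow>
    D \<subseteq> V \<and> (\<forall>v \<in> V - D. \<exists>u \<in> D. N dvd v * u)"
proof -
  let ?G = "zero_divisor_graph (residue_ring N)"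
  have V: "pverts ?G = V"
    using verts_zero_divisor_graph_residue_ring[OF assms(1)] by (simp add: V_def)
  have "parcs ?G = {(u, v). u \<in> pverts ?G \<and> v \<in> pverts ?G \<and> u \<noteq> v \<and> u * v mod N = 0}"
    by (simp add: zero_divisor_graph_def residue_ring_def)
  then have adj: "(v, u) \<in> parcs ?G \<longleftrightarrow> u \<in> V \<and> v \<in> V \<and> v \<noteq> u \<and> N dvd v * u" for u v
    unfolding V by (auto simp only: mod_eq_0_iff_dvd mem_Collect_eq prod.case)
  have arc: "v \<rightarrow>\<^bsub>with_proj ?G\<^esub> u \<longleftrightarrow> u \<in> V \<and> v \<in> V \<and> v \<noteq> u \<and> N dvd v * u" for u v
    by (simp add: adj)
  then show ?thesis unfolding dominating_set_def with_proj_simps(1) V arc by blast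
qed

section \<open>The lowest term of the domination polynomial\<close>

lemma lowest_degree_domination_poly:
  assumes fin: "finite (verts G)" and dom: "\<exists>D. dominating_set G D"
  shows "lowest_degree (domination_poly G) = domination_number G"
    and "lowest_coeff (domination_poly G) =
      int (card {D. dominating_set G D \<and> card D = domination_number G})"
proof -
  have finD: "finite {D. dominating_set G D \<and> card D = i}" for i
    by (rule finite_subset[of _ "Pow (verts G)"]) (use fin in \<open>auto simp: dominating_set_def\<close>)
  have le: "card D \<le> card (verts G)" if "dominating_set G D" for D
    using that fin by (auto simp: dominating_set_def card_mono)
  \<comment> \<open>This holds for every \<open>i\<close>: beyond the number of vertices the
    truncated sum contributes nothing, and no dominating set is that large.\<close>
  have coeff: "coeff (domination_poly G) i = int (num_dominating_sets G i)" for i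
  proof (cases "i \<le> card (verts G)")
    case False
    then have "{D. dominating_set G D \<and> card D = i} = {}" using le by auto
    then have "num_dominating_sets G i = 0" by (simp only: num_dominating_sets_def card.empty)
    then show ?thesis using False by (simp add: domination_poly_def coeff_sum)
  qed (simp add: domination_poly_def coeff_sum)
  have "coeff (domination_poly G) i \<noteq> 0 \<longleftrightarrow> (\<exists>D. dominating_set G D \<and> card D = i)" for i
    using finD[of i] by (auto simp: coeff num_dominating_sets_def)
  then show *: "lowest_degree (domination_poly G) = domination_number G"
    by (simp add: lowest_degree_def domination_number_def)
  show "lowest_coeff (domination_poly G) =
      int (card {D. dominating_set G D \<and> card D = domination_number G})"
    by (simp add: lowest_coeff_def * coeff num_dominating_sets_def)
qed

section \<open>Nonzero annihilators of a divisor of \<open>N\<close>\<close>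

definition annihilators :: "int \<Rightarrow> int \<Rightarrow> int set" where
  "annihilators N q = {x \<in> {0<..<N}. N dvd q * x}"

text \<open>With \<open>N = q * m\<close>, the annihilators are the multiples
  \<open>m, 2 * m, ..., (q - 1) * m\<close>.\<close>

lemma card_annihilators:
  assumes "N > 0" "q > 0" "q dvd N"
  shows "card (annihilators N q) = nat (q - 1)"
proof -
  obtain m where m: "N = q * m" using assms by blast
  then have "m > 0" using assms by (metis zero_less_mult_pos)
  have "annihilators N q = (\<lambda>u. m * u) ` {1..<q}"
  proof (intro equalityI subsetI)
    fix x assume x: "x \<in> annihilators N q"
    then have "m dvd x" using assms(2) by (auto simp: annihilators_def m)
    then obtain u where u: "x = m * u" by blast
    have "0 < m * u" "m * u < m * q"
      using x by (auto simp: annihilators_def m u mult.commute)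
    then have "0 < u" "u < q" using \<open>m > 0\<close> by (auto simp: zero_less_mult_iff)
    then show "x \<in> (\<lambda>u. m * u) ` {1..<q}" using u by auto
  qed (use \<open>m > 0\<close> in \<open>auto simp: annihilators_def m mult.commute[of q]\<close>)
  then show ?thesis using \<open>m > 0\<close> by (simp add: card_image inj_on_def)
qed

text \<open>By Bezout, \<open>x\<close> is an integer combination of \<open>q * x\<close> and
  \<open>r * x\<close>, so \<open>N\<close> would divide \<open>x\<close> although
  \<open>0 < x < N\<close>.\<close>

lemma annihilators_disjoint:
  assumes "coprime q r" "x \<in> annihilators N q" "x \<in> annihilators N r"
  shows False
proof -
  obtain a b where "a * q + b * r = 1"
    using assms(1) bezout_int[of q r] by (auto simp: coprime_iff_gcd_eq_1)
  then have "x = a * (q * x) + b * (r * x)"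
    by (metis mult.assoc distrib_right mult_1)
  moreover have "N dvd a * (q * x) + b * (r * x)"
    using assms(2,3) by (simp add: annihilators_def)
  ultimately have "N dvd x" by simp
  then show False using assms(2) zdvd_imp_le[of N x] by (auto simp: annihilators_def)
qed

section \<open>Minimum dominating sets as choices of annihilators\<close>

lemma minimum_dominating_sets:
  fixes N :: int
  defines "P \<equiv> {q. prime q \<and> q dvd N}"
    and "G \<equiv> with_proj (zero_divisor_graph (residue_ring N))"
  assumes "N > 0" and P3: "card P \<ge> 3"
  shows "domination_number G = card P"
    and "{D. dominating_set G D \<and> card D = card P} = (\<lambda>f. f ` P) ` Pi\<^sub>E P (annihilators N)"
proof -
  let ?B = "annihilators N"
  \<comment> \<open>Enlarging \<open>?B q\<close> by \<open>q\<close> and \<open>N - q\<close> gives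
    sets that every dominating set meets and that are still pairwise disjoint, which yields the
    lower bound.\<close>
  define C where "C = (\<lambda>q. ?B q \<union> {q, N - q})"
  define V where "V = {x \<in> {0<..<N}. \<not> coprime x N}"
  have P_prime: "prime q" "q dvd N" "q > 1" if "q \<in> P" for q
    using that by (auto simp: P_def prime_gt_1_int)
  obtain q0 where "q0 \<in> P" using P3 by fastforce
  then have "N > 1" using P_prime[of q0] \<open>N > 0\<close> zdvd_imp_le[of q0 N] by auto
  note dom = dominating_set_zero_divisor_graph_residue_ring[OF \<open>N > 1\<close>, folded V_def G_def]
  \<comment> \<open>This is where three prime divisors are needed: every prime dividing
    \<open>N\<close> would be \<open>q\<close> or \<open>r\<close>.\<close>
  have not_dvd: "\<not> N dvd q * r" if "prime q" "prime r" for q r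
  proof
    assume "N dvd q * r"
    have "P \<subseteq> {q, r}"
    proof
      fix s assume "s \<in> P"
      then have "s dvd q \<or> s dvd r"
        using P_prime \<open>N dvd q * r\<close> by (meson dvd_trans prime_dvd_mult_iff)
      then show "s \<in> {q, r}" using primes_dvd_imp_eq P_prime(1)[OF \<open>s \<in> P\<close>] that by blast
    qed
    then have "card P \<le> card {q, r}" by (simp add: card_mono)
    also have "\<dots> \<le> 2" by (simp add: card_insert_if)
    finally show False using P3 by simp
  qed
  have not_dvd1: "\<not> N dvd q" if "prime q" for q
    using not_dvd[OF that that] by auto
  have coprimeP: "coprime q r" if "q \<in> P" "r \<in> P" "q \<noteq> r" for q r
    using that P_prime primes_coprime by blast
  have lt: "q < N" if "q \<in> P" for q
  proof -
    have "q \<le> N" using P_prime[OF that] \<open>N > 0\<close> zdvd_imp_le by blast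
    moreover have "q \<noteq> N" using not_dvd1 P_prime[OF that] by auto
    ultimately show ?thesis by simp
  qed
  \<comment> \<open>Equality would force \<open>q\<close> to divide \<open>r\<close>, hence
    \<open>q = r\<close> and \<open>N = 2 * q\<close>, which has at most two prime divisors. The
    case \<open>r = q\<close> says that \<open>q\<close> and \<open>N - q\<close> are
    distinct.\<close>
  have neq: "N - q \<noteq> r" if "q \<in> P" "r \<in> P" for q r
  proof
    assume *: "N - q = r"
    have "q dvd N - q" using P_prime[OF that(1)] by simp
    then have "q = r" using * P_prime(1)[OF that(1)] P_prime(1)[OF that(2)]
      by (metis primes_dvd_imp_eq)
    then have "N dvd 2 * q" using * by simp
    then show False using not_dvd[of 2 q] P_prime(1)[OF that(1)] by simp
  qed
  have vertex: "q \<in> V" "N - q \<in> V" if "q \<in> P" for q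
  proof -
    have "\<not> coprime q N"
      using P_prime[OF that] by (auto dest: coprime_common_divisor[of q N q])
    moreover have "\<not> coprime (N - q) N"
      using P_prime[OF that] by (auto dest: coprime_common_divisor[of "N - q" N q])
    ultimately show "q \<in> V" "N - q \<in> V"
      using lt[OF that] P_prime(3)[OF that] by (auto simp: V_def)
  qed
  have BV: "?B q \<subseteq> V" if "q \<in> P" for q
  proof
    fix x assume x: "x \<in> ?B q"
    have "\<not> coprime x N"
    proof
      assume "coprime x N"
      then have "N dvd q"
        using x by (auto simp: annihilators_def coprime_commute coprime_dvd_mult_left_iff)
      then show False using not_dvd1 P_prime[OF that] by blast
    qed
    then show "x \<in> V" using x by (auto simp: V_def annihilators_def)
  qed
  have notB: "r \<notin> ?B q" "N - r \<notin> ?B q" if "q \<in> P" "r \<in> P" for q r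
  proof -
    have *: "\<not> N dvd q * r" using not_dvd P_prime that by blast
    then show "r \<notin> ?B q" by (simp add: annihilators_def)
    have "N dvd q * (N - r) \<longleftrightarrow> N dvd q * r"
      by (simp add: right_diff_distrib dvd_diff_right_iff)
    then show "N - r \<notin> ?B q" using * by (simp add: annihilators_def)
  qed
  have disjC: "disjoint_family_on C P"
    unfolding disjoint_family_on_def
  proof (intro ballI impI equals0I)
    fix q r x assume qr: "q \<in> P" "r \<in> P" "q \<noteq> r" and "x \<in> C q \<inter> C r"
    then show False
      using annihilators_disjoint[OF coprimeP[OF qr]] notB[OF qr(1,2)] notB[OF qr(2,1)]
        neq[OF qr(1,2)] neq[OF qr(2,1)] by (auto simp: C_def)
  qed
  have disjB: "disjoint_family_on ?B P"
    by (rule disjoint_family_on_bisimulation[OF disjC]) (auto simp: C_def)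
  have adj: "u \<in> ?B q" if "q \<in> P" "u \<in> V" "v \<in> {q, N - q}" "N dvd v * u" for q u v
  proof -
    have "N dvd (N - q) * u \<longleftrightarrow> N dvd q * u"
      by (simp add: left_diff_distrib dvd_diff_right_iff)
    then show ?thesis using that by (auto simp: annihilators_def V_def)
  qed
  have meets: "D \<inter> ?B q \<noteq> {} \<or> {q, N - q} \<subseteq> D" if D: "dominating_set G D" and q: "q \<in> P" for D q
  proof (rule ccontr)
    assume "\<not> ?thesis"
    \<comment> \<open>One of the twins \<open>q\<close> and \<open>N - q\<close> is outside
      \<open>D\<close>, so it needs a neighbour in \<open>D\<close>, and that neighbour annihilates
      \<open>q\<close>.\<close>
    then obtain v where v: "v \<in> {q, N - q}" "v \<notin> D" and *: "D \<inter> ?B q = {}" by blast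
    then have "v \<in> V - D" using vertex[OF q] by blast
    then obtain u where "u \<in> D" "N dvd v * u" using D unfolding dom by blast
    then show False using adj[OF q _ v(1)] D * unfolding dom by blast
  qed
  have transversal: "\<exists>f \<in> Pi\<^sub>E P C. f ` P \<subseteq> D" if "dominating_set G D" for D
  proof -
    have "D \<inter> C q \<noteq> {}" if "q \<in> P" for q
      using meets[OF \<open>dominating_set G D\<close> that] by (auto simp: C_def)
    then show ?thesis by (metis transversal_exists)
  qed
  have finD: "finite D" if "dominating_set G D" for D
    using that finite_subset[of D "{0<..<N}"] unfolding dom V_def by blast
  have cardC: "card (f ` P) = card P" if "f \<in> Pi\<^sub>E P C" for f
    by (rule card_image[OF inj_on_PiE_disjoint[OF disjC that]])
  have lower: "card P \<le> card D" if "dominating_set G D" for D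
    using transversal[OF that] finD[OF that] cardC by (metis card_mono)
  have dominates: "dominating_set G (f ` P)" if f: "f \<in> Pi\<^sub>E P ?B" for f
    unfolding dom
  proof (intro conjI ballI)
    show "f ` P \<subseteq> V" using f BV by fastforce
    fix v assume "v \<in> V - f ` P"
    then have "\<not> coprime v N" by (simp add: V_def)
    then have "\<not> is_unit (gcd v N)" "gcd v N \<noteq> 0" using \<open>N > 0\<close> by auto
    \<comment> \<open>For a prime \<open>q\<close> shared by \<open>v\<close> and \<open>N\<close>,
      the chosen \<open>f q\<close> annihilates \<open>q\<close> and therefore its multiple
      \<open>v\<close>.\<close>
    then obtain q where "prime q" "q dvd gcd v N" using prime_divisorE by blast
    then have q: "prime q" "q dvd v" "q dvd N" by auto
    then have "q \<in> P" by (simp add: P_def)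
    then have "N dvd q * f q" using f by (auto simp: annihilators_def)
    then have "N dvd v * f q" using q(2) by (meson dvd_trans mult_dvd_mono dvd_refl)
    then show "\<exists>u\<in>f ` P. N dvd v * u" using \<open>q \<in> P\<close> by blast
  qed
  have cardB: "card (f ` P) = card P" if "f \<in> Pi\<^sub>E P ?B" for f
    by (rule card_image[OF inj_on_PiE_disjoint[OF disjB that]])
  show *: "{D. dominating_set G D \<and> card D = card P} = (\<lambda>f. f ` P) ` Pi\<^sub>E P ?B"
  proof (intro equalityI subsetI)
    fix D assume "D \<in> {D. dominating_set G D \<and> card D = card P}"
    then have D: "dominating_set G D" "card D = card P" by auto
    obtain f where f: "f \<in> Pi\<^sub>E P C" "f ` P \<subseteq> D" using transversal[OF D(1)] by blast
    then have eq: "D = f ` P"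
      using card_subset_eq[OF finD[OF D(1)] f(2)] D(2) cardC by simp
    \<comment> \<open>Since \<open>D\<close> is exactly a transversal of the disjoint sets
      \<open>C q\<close>, it meets each of them in one point.\<close>
    have only: "x = f q" if q: "q \<in> P" and x: "x \<in> D" "x \<in> C q" for q x
    proof -
      obtain r where r: "r \<in> P" "x = f r" using x(1) eq by blast
      then have "x \<in> C r" using f(1) by auto
      then show ?thesis using disjoint_family_on_eqI[OF disjC q r(1) x(2)] r by simp
    qed
    have "f q \<in> ?B q" if q: "q \<in> P" for q
      using meets[OF D(1) q]
    proof
      assume "{q, N - q} \<subseteq> D"
      then have "q = f q" "N - q = f q" using only[OF q] by (auto simp: C_def)
      then show ?thesis using neq[OF q q] by simp
    next
      assume "D \<inter> ?B q \<noteq> {}"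
      then show ?thesis using only[OF q] by (auto simp: C_def)
    qed
    then have "f \<in> Pi\<^sub>E P ?B" using f(1) by (auto simp: PiE_iff)
    then show "D \<in> (\<lambda>f. f ` P) ` Pi\<^sub>E P ?B" using eq by blast
  qed (use dominates cardB in auto)
  \<comment> \<open>As \<open>q - 1 > 0\<close>, some choice function exists, so the lower bound is
    attained.\<close>
  have "?B q \<noteq> {}" if "q \<in> P" for q
    using card_annihilators[OF \<open>N > 0\<close>, of q] P_prime[OF that] by auto
  then have "Pi\<^sub>E P ?B \<noteq> {}" by (simp add: PiE_eq_empty_iff)
  then have "\<exists>D. dominating_set G D \<and> card D = card P" using * by blast
  then show "domination_number G = card P"
    unfolding domination_number_def by (rule Least_equality) (use lower in auto)
qed

text \<open>Distinct choice functions have distinct images, so the count is the product of the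
  numbers of annihilators.\<close>

lemma card_minimum_dominating_sets:
  fixes N :: int
  defines "P \<equiv> {q. prime q \<and> q dvd N}"
    and "G \<equiv> with_proj (zero_divisor_graph (residue_ring N))"
  assumes "N > 0" and "card P \<ge> 3"
  shows "int (card {D. dominating_set G D \<and> card D = domination_number G}) = (\<Prod>q\<in>P. q - 1)"
proof -
  note min_sets = minimum_dominating_sets[OF assms(3,4)[unfolded P_def], folded P_def G_def]
  have finP: "finite P" using assms(4) card.infinite by fastforce
  have "disjoint_family_on (annihilators N) P"
    unfolding disjoint_family_on_def P_def
    using annihilators_disjoint primes_coprime by blast
  then have "card {D. dominating_set G D \<and> card D = domination_number G} =
      card (Pi\<^sub>E P (annihilators N))"
    unfolding min_sets by (intro card_image inj_on_image_PiE)
  also have "\<dots> = (\<Prod>q\<in>P. nat (q - 1))"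
    unfolding card_PiE[OF finP] using assms(3)
    by (intro prod.cong card_annihilators) (auto simp: P_def prime_gt_0_int)
  also have "int \<dots> = (\<Prod>q\<in>P. q - 1)"
    unfolding of_nat_prod by (intro prod.cong) (auto simp: P_def dest: prime_gt_0_int)
  finally show ?thesis .
qed

theorem theorem3p20:
  fixes n k :: nat and p \<alpha> :: "nat \<Rightarrow> nat"
  assumes "k \<ge> 3"
    and "\<And>i. i \<in> {1..k} \<Longrightarrow> prime (p i)"
    and "inj_on p {1..k}"
    and "\<And>i. i \<in> {1..k} \<Longrightarrow> \<alpha> i > 0"
    and "n = (\<Prod>i = 1..k. p i ^ \<alpha> i)"
  shows "lowest_coeff (domination_poly (zero_divisor_graph (residue_ring (int n))))
           = (\<Prod>i = 1..k. int (p i) - 1)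
       \<and> int (card {D. dominating_set (zero_divisor_graph (residue_ring (int n))) D \<and>
                     card D = domination_number (zero_divisor_graph (residue_ring (int n)))})
           = (\<Prod>i = 1..k. int (p i) - 1)"
proof -
  define P where "P = {q. prime q \<and> q dvd int n}"
  let ?G = "with_proj (zero_divisor_graph (residue_ring (int n)))"
  have "n > 0" using assms(2,5) by (auto simp: prime_gt_0_nat)
  have P: "P = (\<lambda>i. int (p i)) ` {1..k}"
  proof (intro equalityI subsetI)
    fix q assume "q \<in> P"
    then have q: "prime q" "q dvd (\<Prod>i = 1..k. int (p i) ^ \<alpha> i)"
      by (auto simp: P_def assms(5))
    then obtain i where i: "i \<in> {1..k}" "q dvd int (p i) ^ \<alpha> i"
      by (auto simp: prime_dvd_prod_iff)
    then have "q dvd int (p i)" using q(1) prime_dvd_power by blast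
    then show "q \<in> (\<lambda>i. int (p i)) ` {1..k}"
      using primes_dvd_imp_eq[OF q(1), of "int (p i)"] assms(2)[OF i(1)] i(1) by auto
  next
    fix q assume "q \<in> (\<lambda>i. int (p i)) ` {1..k}"
    then obtain i where i: "i \<in> {1..k}" "q = int (p i)" by blast
    \<comment> \<open>Positivity of the exponent ensures that \<open>p i\<close> really divides
      \<open>n\<close>.\<close>
    have "p i dvd p i ^ \<alpha> i" using assms(4)[OF i(1)] by simp
    also have "\<dots> dvd n" unfolding assms(5) by (rule dvd_prodI) (use i in auto)
    finally show "q \<in> P" using i assms(2)[OF i(1)] by (simp add: P_def)
  qed
  have inj: "inj_on (\<lambda>i. int (p i)) {1..k}" using assms(3) unfolding inj_on_def of_nat_eq_iff .
  then have "card P = k" by (simp add: P card_image)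
  then have cardP: "card {q. prime q \<and> q dvd int n} \<ge> 3" using assms(1) by (simp add: P_def)
  have main: "int (card {D. dominating_set ?G D \<and> card D = domination_number ?G})
      = (\<Prod>i = 1..k. int (p i) - 1)"
    using card_minimum_dominating_sets[OF _ cardP, folded P_def] \<open>n > 0\<close>
    unfolding P prod.reindex[OF inj] by (simp add: comp_def)
  have fin: "finite (verts ?G)"
  proof (rule finite_subset)
    show "verts ?G \<subseteq> carrier (residue_ring (int n))"
      by (auto simp: zero_divisor_graph_def zero_divisors_def)
  qed (simp add: residue_ring_def)
  \<comment> \<open>The full vertex set dominates vacuously, so dominating sets exist and the lowest
    term is meaningful.\<close>
  have "dominating_set ?G (verts ?G)" by (simp add: dominating_set_def)
  then have "lowest_coeff (domination_poly ?G) =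
      int (card {D. dominating_set ?G D \<and> card D = domination_number ?G})"
    using lowest_degree_domination_poly(2)[OF fin] by blast
  then show ?thesis
    unfolding main using main by blast
qed

end
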